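(* Let $G$ be a pseudo-outerplanar graph. Then (a) $\delta(G)\leq 3$; and (b) $\kappa(G)\leq 2$ unless $G\cong K_4$.
   Context: All graphs are finite, simple and undirected. A block is a maximal 2-connected subgraph; bridges are blocks too. A graph is pseudo-outerplanar if each of its blocks can be drawn in the plane so that its vertices lie on a fixed circle, its edges lie inside the disk bounded by that circle, and each edge crosses at most one other edge. $\delta(G)$ is the minimum degree of $G$. $\kappa(G)$ is the vertex connectivity: the minimum number of vertices whose deletion disconnects $G$. *)

theory Defs
  imports "HOL-Analysis.Analysis" "Graph_Theory.Graph_Theory"
begin

text \<open>
  Finite simple undirected graphs are modelled, as in the library, by symmetric loop-free finite
  digraphs without parallel arcs (locale \<^locale>\<open>graph\<close>): an undirected edge is a pair of opposite
  arcs, and the degree of a vertex is its \<^const>\<open>out_degree\<close>.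
\<close>

definition uedges :: "('a, 'b) pre_digraph \<Rightarrow> 'a set set" where
  "uedges G = {{u, v} |u v. (u, v) \<in> arcs_ends G}"

text \<open>Unspecified for the graph without vertices.\<close>

definition min_degree :: "('a, 'b) pre_digraph \<Rightarrow> nat" where
  "min_degree G = Min (out_degree G ` verts G)"

text \<open>
  No vertex deletion disconnects a complete graph. The first disjunct implements the usual
  convention that deleting all but one vertex also counts, so that the connectivity of the complete
  graph on \<open>n > 0\<close> vertices is \<open>n - 1\<close>; it does not affect the value for any other graph.
  The library's \<^const>\<open>Digraph_Component.connected\<close> is false for the graph without vertices, but for
  nonempty graphs the minimum is never attained by deleting all vertices.
\<close>

definition vertex_connectivity :: "('a, 'b) pre_digraph \<Rightarrow> nat" where
  "vertex_connectivity G = (LEAST k. \<exists>S \<subseteq> verts G. card S = k \<and>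
     (card (verts G - S) \<le> 1 \<or> \<not> Digraph_Component.connected (G \<restriction> (verts G - S))))"

definition two_connected :: "('a, 'b) pre_digraph \<Rightarrow> bool" where
  "two_connected G \<longleftrightarrow> graph G \<and> 2 \<le> vertex_connectivity G"

definition bridge :: "('a, 'b) pre_digraph \<Rightarrow> 'a \<Rightarrow> 'a \<Rightarrow> bool" where
  "bridge G u v \<longleftrightarrow> (u, v) \<in> arcs_ends G \<and>
     \<not> u \<rightarrow>\<^sup>*\<^bsub>G\<lparr>arcs := {a \<in> arcs G. {tail G a, head G a} \<noteq> {u, v}}\<rparr>\<^esub> v"

definition block :: "('a, 'b) pre_digraph \<Rightarrow> ('a, 'b) pre_digraph \<Rightarrow> bool" where
  "block G B \<longleftrightarrow> pre_digraph.max_subgraph G two_connected B \<or>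
     (\<exists>u v. bridge G u v \<and> B = G \<restriction> {u, v})"

text \<open>
  A drawing places the vertices by \<open>pos\<close> and draws the edge \<open>e\<close> as the simple curve \<open>\<gamma> e\<close> (in either
  direction), which contains no vertices besides its ends. Edges may run along the boundary circle.
\<close>

definition drawing_in_disk ::
  "('a, 'b) pre_digraph \<Rightarrow> complex \<Rightarrow> real \<Rightarrow> ('a \<Rightarrow> complex) \<Rightarrow> ('a set \<Rightarrow> real \<Rightarrow> complex) \<Rightarrow> bool"
where
  "drawing_in_disk G c r pos \<gamma> \<longleftrightarrow>
     inj_on pos (verts G) \<and> pos ` verts G \<subseteq> sphere c r \<and>
     (\<forall>e \<in> uedges G. arc (\<gamma> e) \<and> {pathstart (\<gamma> e), pathfinish (\<gamma> e)} = pos ` e \<and>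
        path_image (\<gamma> e) \<inter> pos ` verts G = pos ` e \<and> path_image (\<gamma> e) \<subseteq> cball c r)"

text \<open>Two different edges cross if they share a point that is not the position of a common end.\<close>

definition crosses ::
  "('a \<Rightarrow> complex) \<Rightarrow> ('a set \<Rightarrow> real \<Rightarrow> complex) \<Rightarrow> 'a set \<Rightarrow> 'a set \<Rightarrow> bool"
where
  "crosses pos \<gamma> e f \<longleftrightarrow>
     e \<noteq> f \<and> \<not> path_image (\<gamma> e) \<inter> path_image (\<gamma> f) \<subseteq> pos ` (e \<inter> f)"

definition pseudo_outerplanar :: "('a, 'b) pre_digraph \<Rightarrow> bool" where
  "pseudo_outerplanar G \<longleftrightarrow>
     (\<forall>B. block G B \<longrightarrow>
        (\<exists>c r pos \<gamma>. 0 < r \<and> drawing_in_disk B c r pos \<gamma> \<and>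
           (\<forall>e \<in> uedges B. card {f \<in> uedges B. crosses pos \<gamma> e f} \<le> 1)))"

end

theory Submission
  imports Defs
begin

text \<open>
  Two edges of a drawing whose ends alternate on the circle cross, so a drawing yields a linear order
  of the vertices (the circle cut open at a point) in which every chord alternates with at most one
  other. If the chords \<open>ac\<close> and \<open>bd\<close> alternate, no edge leaves any of the four arcs of the circle
  between consecutive ends. Hence, with at least five vertices and a proper chord, two vertices form
  a cut, which gives (b). For (a), a smallest nondegenerate arc without leaving edges has an inner
  vertex of degree at most 3; this is applied to an end block, with the circle cut at its cut vertex.
\<close>

section \<open>Alternating chords of a disk\<close>

text \<open>The edges are arbitrary arcs, not segments, so nothing metric can be used. The drawing
  enters only through one implication: alternating ends force a crossing. From there on the argument
  is about finite linear orders. Curves may also cross without alternating; this only uses up the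
  allowance of one crossing per edge. A bound for a block does not give (a) directly: its low-degree
  vertex may have further neighbours in other blocks. An end block has a single vertex of that kind.
  Cutting the circle there makes it an end of the outermost arc, while the vertex that is found is
  an inner one. In (b) the exception is due to counting: two alternating chords have four ends, and
  only a fifth vertex makes one of the four arcs nonempty.\<close>

text \<open>
  The paths are prolonged radially to the disk of radius \<open>2 * r\<close>, so that the Moebius map sending
  that disk to the upper half plane and \<open>2 * p\<close> to infinity is bounded on them even if they run
  through \<open>p\<close>. The half plane case is the Fashoda theorem.
\<close>

lemma interlaced_paths_in_disk_meet:
  fixes f g :: "real \<Rightarrow> complex" and p :: complex
  defines "h \<equiv> \<lambda>z. Re (\<i> * (p + z) / (p - z))"
  assumes p: "norm p = r" "0 < r"
    and f: "path f" "path_image f \<subseteq> cball 0 r"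
    and g: "path g" "path_image g \<subseteq> cball 0 r"
    and fs: "norm (pathstart f) = r" "pathstart f \<noteq> p"
    and ff: "norm (pathfinish f) = r" "pathfinish f \<noteq> p"
    and gs: "norm (pathstart g) = r" "pathstart g \<noteq> p"
    and gf: "norm (pathfinish g) = r" "pathfinish g \<noteq> p"
    and h: "h (pathstart f) < h (pathstart g)" "h (pathstart g) < h (pathfinish f)"
      "h (pathfinish f) < h (pathfinish g)"
  shows "path_image f \<inter> path_image g \<noteq> {}"
proof -
  define M where "M z = \<i> * (2*p + z) / (2*p - z)" for z
  define V :: "complex \<Rightarrow> real^2" where "V z = Re z *\<^sub>R axis 1 1 + Im z *\<^sub>R axis 2 1" for z
  define ext where "ext f = linepath (2 * pathstart f) (pathstart f) +++ f +++ linepath (pathfinish f) (2 * pathfinish f)"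
    for f :: "real \<Rightarrow> complex"
  have V1: "V z $ 1 = Re z" and V2: "V z $ 2 = Im z" for z
    by (simp_all add: V_def axis_def)
  have V_cont: "continuous_on S V" for S
    unfolding V_def by (intro continuous_intros)
  have ray: "\<exists>t\<ge>1. t \<le> 2 \<and> z = complex_of_real t * a"
    if "z \<in> closed_segment a (2 * a) \<or> z \<in> closed_segment (2 * a) a" for a z :: complex
  proof -
    have "z \<in> closed_segment a (2 * a)" using that closed_segment_commute by blast
    then obtain u where "0 \<le> u" "u \<le> 1" "z = (1 - u) *\<^sub>R a + u *\<^sub>R (2 * a)"
      by (auto simp: in_segment)
    then show ?thesis
      by (intro exI[of _ "1 + u"]) (auto simp: scaleR_conv_of_real algebra_simps)
  qed
  have ext_image: "z \<in> path_image k \<or> (\<exists>t\<ge>1. t \<le> 2 \<and> z = of_real t * pathstart k) \<or>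
      (\<exists>t\<ge>1. t \<le> 2 \<and> z = of_real t * pathfinish k)"
    if "path k" "z \<in> path_image (ext k)" for k z
    using that ray unfolding ext_def by (auto simp: path_image_join)
  have ext: "path (ext k)" "pathstart (ext k) = 2 * pathstart k" "pathfinish (ext k) = 2 * pathfinish k"
    if "path k" for k
    using that by (auto simp: ext_def)
  \<comment> \<open>A path stays within radius \<open>r\<close>, and a ray has norm
    \<open>2 * r\<close> only at its tip \<open>2 * a\<close>, where \<open>a\<close> is an end of
    the path and thus not \<open>p\<close>.\<close>
  have bound: "norm z \<le> 2 * r \<and> z \<noteq> 2 * p"
    if k: "path k" "path_image k \<subseteq> cball 0 r" "norm (pathstart k) = r" "pathstart k \<noteq> p"
      "norm (pathfinish k) = r" "pathfinish k \<noteq> p" and z: "z \<in> path_image (ext k)" for k z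
    using ext_image[OF k(1) z]
  proof (elim disjE exE conjE)
    assume "z \<in> path_image k"
    then have "norm z \<le> r" using k(2) by auto
    moreover have "norm (2 * p) = 2 * r" using p by (simp add: norm_mult)
    ultimately show ?thesis using p by auto
  next
    fix t :: real assume t: "1 \<le> t" "t \<le> 2" "z = of_real t * pathstart k"
    then have n: "norm z = t * r" using k by (simp add: norm_mult)
    have "t = 2" if "z = 2 * p"
      using n that p by (auto simp: norm_mult)
    then show ?thesis using n t k p by (auto simp: mult_right_mono)
  next
    fix t :: real assume t: "1 \<le> t" "t \<le> 2" "z = of_real t * pathfinish k"
    then have n: "norm z = t * r" using k by (simp add: norm_mult)
    have "t = 2" if "z = 2 * p"
      using n that p by (auto simp: norm_mult)
    then show ?thesis using n t k p by (auto simp: mult_right_mono)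
  qed
  \<comment> \<open>The numerator is nonnegative on the disk of radius \<open>2 * r\<close> and zero
    on its boundary, so the prolonged paths land in the closed upper half plane with their ends on
    the real axis.\<close>
  have M_Im: "Im (M z) = (4 * r\<^sup>2 - (norm z)\<^sup>2) / (norm (2*p - z))\<^sup>2" for z
  proof -
    have "r\<^sup>2 = (Re p)\<^sup>2 + (Im p)\<^sup>2" using p by (auto simp: cmod_power2)
    then show ?thesis unfolding M_def
      by (simp add: Im_divide cmod_power2) (simp add: power2_eq_square algebra_simps)
  qed
  have M_inj: "z = w" if "M z = M w" "z \<noteq> 2 * p" "w \<noteq> 2 * p" for z w
  proof -
    have "p \<noteq> 0" using p by auto
    have "(2*p + z) * (2*p - w) = (2*p + w) * (2*p - z)"
      using that unfolding M_def by (simp add: divide_simps)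
    then have "p * z = p * w" by (simp add: algebra_simps)
    then show ?thesis using \<open>p \<noteq> 0\<close> by simp
  qed
  \<comment> \<open>This transfers the order of the ends, assumed for \<open>h\<close> on the circle
    of radius \<open>r\<close>, to the tips of the rays.\<close>
  have M2: "Re (M (2 * z)) = h z" for z
  proof -
    have "M (2 * z) = \<i> * (2 * (p + z)) / (2 * (p - z))" by (simp add: M_def algebra_simps)
    then show ?thesis unfolding h_def by (metis mult.left_commute mult_divide_mult_cancel_left_if zero_neq_numeral)
  qed
  have comp: "path (V \<circ> M \<circ> ext k)" "bounded (path_image (V \<circ> M \<circ> ext k))"
    "\<forall>w\<in>path_image (V \<circ> M \<circ> ext k). 0 \<le> w $ 2"
    if k: "path k" "path_image k \<subseteq> cball 0 r" "norm (pathstart k) = r" "pathstart k \<noteq> p"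
      "norm (pathfinish k) = r" "pathfinish k \<noteq> p" for k
  proof -
    have "2 * p \<notin> path_image (ext k)" using bound[OF k] by blast
    then have "continuous_on (path_image (ext k)) M"
      unfolding M_def by (intro continuous_intros) auto
    then show P: "path (V \<circ> M \<circ> ext k)"
      using ext[OF k(1)] V_cont
      by (metis path_continuous_image continuous_on_compose comp_assoc)
    show "bounded (path_image (V \<circ> M \<circ> ext k))" using P bounded_path_image by blast
    show "\<forall>w\<in>path_image (V \<circ> M \<circ> ext k). 0 \<le> w $ 2"
      using bound[OF k] by (auto simp: path_image_compose V2 M_Im intro!: divide_nonneg_nonneg)
        (metis norm_ge_zero power_mono power_mult_distrib four_x_squared)
  qed
  note cf = comp[OF f fs ff] and cg = comp[OF g gs gf]
  define F G where "F = V \<circ> M \<circ> ext f" and "G = V \<circ> M \<circ> ext g"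
  obtain K where K: "\<And>w. w \<in> path_image F \<union> path_image G \<Longrightarrow> norm w \<le> K"
    using cf(2) cg(2) unfolding F_def G_def by (metis bounded_Un bounded_iff)
  \<comment> \<open>\<open>fashoda_interlace\<close> wants the four ends on the bottom side of a box
    containing both paths. \<open>K\<close> bounds both images, and the bottom side lies on the real
    axis.\<close>
  define a b :: "real^2" where "a = vector [-K, 0]" and "b = vector [K, K]"
  have box: "w \<in> cbox a b" if "w \<in> path_image F \<union> path_image G" for w
  proof -
    have "\<bar>w $ i\<bar> \<le> K" for i using K[OF that] component_le_norm_cart order_trans by blast
    then have "\<bar>w $ 1\<bar> \<le> K" "\<bar>w $ 2\<bar> \<le> K" by auto
    then show ?thesis using cf(3) cg(3) that unfolding F_def G_def
      by (auto simp: a_def b_def mem_box_cart forall_2)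
  qed
  have ends: "pathstart (V \<circ> M \<circ> ext k) = V (M (2 * pathstart k))" "pathfinish (V \<circ> M \<circ> ext k) = V (M (2 * pathfinish k))"
    if "path k" for k using ext[OF that] by (auto simp: pathstart_def pathfinish_def)
  have Im0: "Im (M (2 * z)) = 0" if "norm z = r" for z
    using that by (simp add: M_Im norm_mult power_mult_distrib)
  obtain w where w: "w \<in> path_image F" "w \<in> path_image G"
  proof (rule fashoda_interlace[of F G a b])
    show "path F" "path G" using cf(1) cg(1) by (auto simp: F_def G_def)
    show "path_image F \<subseteq> cbox a b" "path_image G \<subseteq> cbox a b" using box by auto
  qed (auto simp: F_def G_def ends f(1) g(1) V1 V2 Im0 fs ff gs gf a_def M2 h)
  obtain z where z: "z \<in> path_image (ext f)" "z \<in> path_image (ext g)"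
  proof -
    obtain z1 z2 where "z1 \<in> path_image (ext f)" "z2 \<in> path_image (ext g)" "V (M z1) = w" "V (M z2) = w"
      using w by (auto simp: F_def G_def path_image_compose)
    moreover from this have "M z1 = M z2"
      by (metis V1 V2 complex_eq_iff)
    ultimately have "z1 = z2" using M_inj bound[OF f fs ff] bound[OF g gs gf] by metis
    then show ?thesis using \<open>z1 \<in> _\<close> \<open>z2 \<in> _\<close> that by blast
  qed
  have on_ray: "z' = a" if "z' = of_real t * a" "1 \<le> t" "norm a = r" "norm z' \<le> r" for z' a :: complex and t :: real
  proof -
    have "t * r \<le> 1 * r" using that by (simp add: norm_mult)
    then have "t \<le> 1" using p(2) by (simp only: mult_le_cancel_right)
    then show ?thesis using that by auto
  qed
  have rays: "a = b" if "of_real s * a = of_real t * b" "1 \<le> s" "1 \<le> t" "norm a = r" "norm b = r"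
    for a b :: complex and s t :: real
  proof -
    have "norm (of_real s * a) = norm (of_real t * b)" using that by simp
    then have "\<bar>s\<bar> * r = \<bar>t\<bar> * r" unfolding norm_mult that(4,5) norm_of_real .
    then have "s = t" using that p by simp
    then show ?thesis using that by simp
  qed
  have ne: "pathstart f \<noteq> pathstart g" "pathstart f \<noteq> pathfinish g" "pathfinish f \<noteq> pathstart g" "pathfinish f \<noteq> pathfinish g"
    using h by auto
  have inner: "z \<in> path_image k"
    if k: "path k" "norm (pathstart k) = r" "norm (pathfinish k) = r" and z: "z \<in> path_image (ext k)" "norm z \<le> r" for k
    using ext_image[OF k(1) z(1)]
  proof (elim disjE exE conjE)
    fix t :: real assume "1 \<le> t" "z = of_real t * pathstart k"
    then have "z = pathstart k" using on_ray k(2) z(2) by blast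
    then show ?thesis by (simp add: pathstart_in_path_image)
  next
    fix t :: real assume "1 \<le> t" "z = of_real t * pathfinish k"
    then have "z = pathfinish k" using on_ray k(3) z(2) by blast
    then show ?thesis by (simp add: pathfinish_in_path_image)
  qed
  have outer: "\<exists>t a. 1 \<le> t \<and> z = complex_of_real t * a \<and> a \<in> {pathstart k, pathfinish k}"
    if "path k" "path_image k \<subseteq> cball 0 r" "z \<in> path_image (ext k)" "\<not> norm z \<le> r" for k
  proof -
    have "z \<notin> path_image k" using that(2,4) by auto
    then show ?thesis using ext_image[OF that(1,3)] by blast
  qed
  \<comment> \<open>A common point within radius \<open>r\<close> lies on both original paths, since
    a ray meets that disk only in its foot. Farther out it would lie on two rays, which then have
    the same foot, but the four ends are distinct.\<close>
  show ?thesis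
  proof (cases "norm z \<le> r")
    case True
    then show ?thesis using inner[OF f(1) fs(1) ff(1) z(1)] inner[OF g(1) gs(1) gf(1) z(2)] by blast
  next
    case False
    obtain s a where a: "1 \<le> s" "z = complex_of_real s * a" "a \<in> {pathstart f, pathfinish f}"
      using outer[OF f z(1) False] by blast
    obtain t b where b: "1 \<le> t" "z = complex_of_real t * b" "b \<in> {pathstart g, pathfinish g}"
      using outer[OF g z(2) False] by blast
    have "norm a = r" "norm b = r" using a(3) b(3) fs ff gs gf by auto
    then have "a = b" using rays[of s a t b] a b by simp
    then show ?thesis using a(3) b(3) ne by auto
  qed
qed

section \<open>Circular layouts\<close>

text \<open>In \<open>crossed_once\<close>, the edges \<open>bd\<close> and \<open>b'd'\<close> alternate with \<open>ac\<close>; of their ends, \<open>b\<close> and \<open>b'\<close>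
  are the ones between \<open>a\<close> and \<open>c\<close>.\<close>

locale circular_layout =
  fixes V :: "'a set" and E :: "('a \<times> 'a) set" and h :: "'a \<Rightarrow> real"
  assumes fin: "finite V"
    and edges: "E \<subseteq> V \<times> V"
    and sym: "(x, y) \<in> E \<Longrightarrow> (y, x) \<in> E"
    and irrefl: "(x, x) \<notin> E"
    and inj: "inj_on h V"
    and crossed_once: "\<lbrakk>(a, c) \<in> E; (b, d) \<in> E; (b', d') \<in> E;
      h a < h b; h b < h c; h d < h a \<or> h c < h d;
      h a < h b'; h b' < h c; h d' < h a \<or> h c < h d'\<rbrakk> \<Longrightarrow> b = b' \<and> d = d'"
begin

definition between :: "'a \<Rightarrow> 'a \<Rightarrow> 'a set" where
  "between a b = {x \<in> V. h a < h x \<and> h x < h b}"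

text \<open>Edges at \<open>a\<close> and \<open>b\<close> themselves are unrestricted, as befits a
  pair of vertices that is to be a cut.\<close>

definition enclosed :: "'a \<Rightarrow> 'a \<Rightarrow> bool" where
  "enclosed a b \<longleftrightarrow> (\<forall>(x, y) \<in> E. h a < h x \<and> h x < h b \<longrightarrow> h a \<le> h y \<and> h y \<le> h b)"

lemma enclosedD: "enclosed a b \<Longrightarrow> (x, y) \<in> E \<Longrightarrow> h a < h x \<Longrightarrow> h x < h b \<Longrightarrow> h a \<le> h y \<and> h y \<le> h b"
  unfolding enclosed_def by blast

lemma h_eqD: "x \<in> V \<Longrightarrow> y \<in> V \<Longrightarrow> h x = h y \<Longrightarrow> x = y"
  using inj by (auto dest: inj_onD)

lemma h_neq: "(x, y) \<in> E \<Longrightarrow> h x \<noteq> h y"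
  using h_eqD edges irrefl by blast

lemma uncrossed_enclosed:
  assumes "(a, c) \<in> E"
    and "\<And>b d. \<lbrakk>(b, d) \<in> E; h a < h b; h b < h c\<rbrakk> \<Longrightarrow> \<not> (h d < h a \<or> h c < h d)"
  shows "enclosed a c"
  using assms unfolding enclosed_def by (auto simp: not_less)

text \<open>An edge leaving one of these arcs alternates with \<open>ac\<close> or with
  \<open>bd\<close>. The only edge allowed to do so is the other one of the two, and that one has no
  end strictly inside the arc.\<close>

lemma crossed_enclosed:
  assumes ac: "(a, c) \<in> E" and bd: "(b, d) \<in> E"
    and alt: "h a < h b" "h b < h c" "h d < h a \<or> h c < h d"
  shows "enclosed a b" "enclosed b c"
proof -
  have ca: "(c, a) \<in> E" and db: "(d, b) \<in> E" using ac bd sym by auto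
  have V: "a \<in> V" "b \<in> V" "c \<in> V" "d \<in> V" using ac bd edges by auto
  \<comment> \<open>\<open>key\<close> includes \<open>y = c\<close> and \<open>key'\<close>
    includes \<open>x = a\<close>: such edges share an end with \<open>ac\<close>, but still
    alternate with \<open>bd\<close>. The cases on \<open>d\<close> decide which end of
    \<open>bd\<close> is the lower one in \<open>crossed_once\<close>.\<close>
  have key: "\<not> ((h a < h x \<and> h x < h b) \<and> (h b < h y \<and> h y \<le> h c))" if xy: "(x, y) \<in> E" for x y
  proof
    assume *: "(h a < h x \<and> h x < h b) \<and> (h b < h y \<and> h y \<le> h c)"
    have yx: "(y, x) \<in> E" using xy sym by auto
    from alt(3) show False
    proof
      assume "h d < h a"
      then have "a = x" using crossed_once[OF db ac xy] alt * by auto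
      then show False using * by auto
    next
      assume "h c < h d"
      then have "a = x" using crossed_once[OF bd ca yx] alt * by auto
      then show False using * by auto
    qed
  qed
  have key': "\<not> ((h a \<le> h x \<and> h x < h b) \<and> (h b < h y \<and> h y < h c))" if xy: "(x, y) \<in> E" for x y
  proof
    assume *: "(h a \<le> h x \<and> h x < h b) \<and> (h b < h y \<and> h y < h c)"
    have yx: "(y, x) \<in> E" using xy sym by auto
    from alt(3) show False
    proof
      assume "h d < h a"
      then have "c = y" using crossed_once[OF db ac xy] alt * by auto
      then show False using * by auto
    next
      assume "h c < h d"
      then have "c = y" using crossed_once[OF bd ca yx] alt * by auto
      then show False using * by auto
    qed
  qed
  have out: "x = b" if "(x, y) \<in> E" "h a < h x" "h x < h c" "h y < h a \<or> h c < h y" for x y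
    using crossed_once[OF ac bd that(1)] alt that by auto
  show "enclosed a b"
    unfolding enclosed_def
  proof (clarify)
    fix x y assume xy: "(x, y) \<in> E" and "h a < h x" "h x < h b"
    then show "h a \<le> h y \<and> h y \<le> h b"
      using key[OF xy] out[OF xy] alt by (auto simp: not_less not_le) (smt (verit))+
  qed
  show "enclosed b c"
    unfolding enclosed_def
  proof (clarify)
    fix x y assume xy: "(x, y) \<in> E" and "h b < h x" "h x < h c"
    then show "h b \<le> h y \<and> h y \<le> h c"
      using key'[OF sym[OF xy]] out[OF xy] alt by (auto simp: not_less not_le) (smt (verit))+
  qed
qed

text \<open>Let \<open>x\<close> be the leftmost inner vertex and \<open>z\<close> its farthest
  neighbour to the right. The 3 accounts for \<open>a\<close>, \<open>z\<close> and the end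
  \<open>e\<close> between \<open>x\<close> and \<open>z\<close> of a chord crossing
  \<open>xz\<close>. A fourth neighbour lies strictly inside the arc \<open>xz\<close> or, if that
  is crossed, inside \<open>xe\<close> or \<open>ez\<close>, and this arc is enclosed and has fewer
  inner vertices.\<close>

lemma enclosed_small_degree:
  assumes "enclosed a b" "a \<in> V" "between a b \<noteq> {}"
  shows "\<exists>x\<in>between a b. card (E `` {x}) \<le> 3"
  using assms
proof (induction "card (between a b)" arbitrary: a b rule: less_induct)
  case less
  have fin_b: "finite (between s t)" for s t using fin by (auto simp: between_def)
  define x where "x = arg_min_on h (between a b)"
  have x: "x \<in> between a b" and x_min: "\<And>y. y \<in> between a b \<Longrightarrow> h x \<le> h y"
    unfolding x_def using arg_min_if_finite[OF fin_b less.prems(3), of h] by (auto simp: not_less)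
  show ?case
  proof (cases "card (E `` {x}) \<le> 3")
    case False
    define U where "U = E `` {x} - {a}"
    have finU: "finite U" unfolding U_def using finite_subset[OF edges] fin by auto
    have U3: "3 \<le> card U" using False unfolding U_def by (auto simp: card_Diff_singleton_if)
    have U: "(x, y) \<in> E \<and> y \<in> V \<and> h x < h y \<and> h y \<le> h b" if "y \<in> U" for y
    proof -
      have xy: "(x, y) \<in> E" "y \<in> V" "y \<noteq> a" using that edges by (auto simp: U_def)
      have "h a \<le> h y" "h y \<le> h b" using enclosedD[OF less.prems(1) xy(1)] x by (auto simp: between_def)
      moreover have "h y \<noteq> h a" using h_eqD xy less.prems(2) by blast
      moreover have "h x \<noteq> h y" using h_neq xy by blast
      ultimately show ?thesis using xy x x_min[of y] by (fastforce simp: between_def)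
    qed
    define z where "z = arg_min_on (\<lambda>y. - h y) U"
    have "U \<noteq> {}" using U3 by auto
    then have z: "z \<in> U" and z_max: "\<And>y. y \<in> U \<Longrightarrow> h y \<le> h z"
      unfolding z_def using arg_min_if_finite[OF finU, of "\<lambda>y. - h y"] by (auto simp: not_less)
    have "2 \<le> card (U - {z})" using U3 z by simp
    then obtain T where "T \<subseteq> U - {z}" "card T = 2" by (meson obtain_subset_with_card_n)
    then obtain y1 y2 where y: "y1 \<in> U - {z}" "y2 \<in> U - {z}" "y1 \<noteq> y2"
      by (auto simp: card_2_iff)
    have yz: "y \<in> between x z" if "y \<in> U - {z}" for y
    proof -
      have "h y \<noteq> h z" using h_eqD U that z by blast
      then show ?thesis using that U z_max by (fastforce simp: between_def)
    qed
    have xz: "(x, z) \<in> E" "x \<in> V" using U z edges by auto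
    \<comment> \<open>An arc starting at \<open>x\<close> or later no longer has \<open>x\<close> as
      an inner vertex, so the induction measure drops.\<close>
    have sub: ?thesis if "enclosed s t" "s \<in> V" "between s t \<noteq> {}" "h x \<le> h s" "h t \<le> h z" for s t
    proof -
      have "h z \<le> h b" using U z by blast
      then have ss: "between s t \<subseteq> between a b - {x}"
        using that x by (auto simp: between_def)
      then have "card (between s t) < card (between a b)"
        using x by (intro psubset_card_mono fin_b) auto
      from less.hyps[OF this that(1-3)] show ?thesis using ss by auto
    qed
    show ?thesis
    proof (cases "\<exists>e f. (e, f) \<in> E \<and> h x < h e \<and> h e < h z \<and> (h f < h x \<or> h z < h f)")
      case False
      then have "enclosed x z" using uncrossed_enclosed[OF xz(1)] by blast
      then show ?thesis using sub[of x z] xz yz y by auto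
    next
      case True
      then obtain e f where ef: "(e, f) \<in> E" "h x < h e" "h e < h z" "h f < h x \<or> h z < h f" by blast
      have enc: "enclosed x e" "enclosed e z" using crossed_enclosed[OF xz(1) ef] by auto
      have eV: "e \<in> V" using ef edges by auto
      obtain y' where y': "y' \<in> between x z" "y' \<noteq> e" using y yz by metis
      then have "h y' \<noteq> h e" using h_eqD eV by (auto simp: between_def)
      then have "y' \<in> between x e \<or> y' \<in> between e z" using y' by (auto simp: between_def)
      then show ?thesis
      proof
        assume "y' \<in> between x e"
        then show ?thesis using sub[of x e] enc xz ef by auto
      next
        assume "y' \<in> between e z"
        then show ?thesis using sub[of e z] enc eV ef by auto
      qed
    qed
  qed (use x in auto)
qed

text \<open>The arc from the first vertex \<open>v\<close> to the last one contains everything, so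
  it is enclosed; its inner vertices differ from \<open>v\<close>, and a third vertex makes it
  nondegenerate.\<close>

lemma obtain_small_degree:
  assumes v: "v \<in> V" "\<And>x. x \<in> V \<Longrightarrow> h v \<le> h x" and "3 \<le> card V"
  obtains x where "x \<in> V" "x \<noteq> v" "card (E `` {x}) \<le> 3"
proof -
  define w where "w = arg_min_on (\<lambda>y. - h y) V"
  have w: "w \<in> V" "\<And>y. y \<in> V \<Longrightarrow> h y \<le> h w"
    unfolding w_def using arg_min_if_finite[OF fin, of "\<lambda>y. - h y"] v by (auto simp: not_less)
  have "card {v, w} < card V" using assms(3) by (auto simp: card_insert_if)
  then have "\<not> V \<subseteq> {v, w}" by (meson card_mono finite.emptyI finite.insertI linorder_not_le)
  then obtain z where z: "z \<in> V" "z \<noteq> v" "z \<noteq> w" by auto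
  then have "h z \<noteq> h v" "h z \<noteq> h w" using h_eqD v w by metis+
  then have "z \<in> between v w" using v w z by (fastforce simp: between_def)
  moreover have "enclosed v w" unfolding enclosed_def using v w edges by fast
  ultimately obtain x where "x \<in> between v w" "card (E `` {x}) \<le> 3"
    using enclosed_small_degree v by blast
  then show ?thesis using that by (auto simp: between_def)
qed

text \<open>The middle one \<open>c\<close> of three neighbours of \<open>v\<close> gives a chord
  \<open>vc\<close> with vertices on both sides. If no edge alternates with it, its ends are the
  cut. If \<open>bd\<close> does, a fifth vertex lies in one of the four arcs, and the ends of that
  arc are the cut.\<close>

lemma obtain_two_cut:
  assumes v: "v \<in> V" "\<And>x. x \<in> V \<Longrightarrow> h v \<le> h x" and n: "5 \<le> card V" and deg: "3 \<le> card (E `` {v})"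
  obtains s t I where "s \<in> V" "t \<in> V" "I \<noteq> {}" "I \<subset> V - {s, t}"
    "E `` I \<subseteq> I \<union> {s, t}"
proof -
  note result = that
  \<comment> \<open>The vertex \<open>u\<close> on the other side keeps \<open>between s t\<close>
    from being all of \<open>V - {s, t}\<close>.\<close>
  have cut: thesis
    if st: "enclosed s t" "s \<in> V" "t \<in> V" and z: "z \<in> between s t" and u: "u \<in> V" "h u < h s \<or> h t < h u"
    for s t z u
  proof (rule result[of s t "between s t"])
    have "h s < h t" using z by (auto simp: between_def)
    then have "u \<in> V - {s, t} - between s t" using u by (auto simp: between_def)
    moreover have "between s t \<subseteq> V - {s, t}" by (auto simp: between_def)
    ultimately show "between s t \<subset> V - {s, t}" by blast
    show "E `` between s t \<subseteq> between s t \<union> {s, t}"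
    proof
      fix y assume "y \<in> E `` between s t"
      then obtain x where xy: "(x, y) \<in> E" "x \<in> between s t" by auto
      then have "h s \<le> h y" "h y \<le> h t" using enclosedD[OF st(1) xy(1)] by (auto simp: between_def)
      moreover have "y \<in> V" using xy edges by auto
      moreover have "y = s" if "h y = h s" using h_eqD[OF \<open>y \<in> V\<close> st(2) that] .
      moreover have "y = t" if "h y = h t" using h_eqD[OF \<open>y \<in> V\<close> st(3) that] .
      ultimately show "y \<in> between s t \<union> {s, t}" by (auto simp: between_def order_le_less)
    qed
  qed (use st z in blast)+
  obtain T where "T \<subseteq> E `` {v}" "card T = 3" using deg by (meson obtain_subset_with_card_n)
  then obtain w1 w2 w3 where w: "{w1, w2, w3} \<subseteq> E `` {v}" "w1 \<noteq> w2" "w1 \<noteq> w3" "w2 \<noteq> w3"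
    by (auto simp: card_3_iff)
  then have wV: "w1 \<in> V" "w2 \<in> V" "w3 \<in> V" using edges by auto
  have "h w1 \<noteq> h w2" "h w1 \<noteq> h w3" "h w2 \<noteq> h w3" using w wV h_eqD by metis+
  then obtain x c y where xcy: "{x, c, y} \<subseteq> E `` {v}" "h x < h c" "h c < h y"
  proof -
    assume *: "\<And>x c y. {x, c, y} \<subseteq> E `` {v} \<Longrightarrow> h x < h c \<Longrightarrow> h c < h y \<Longrightarrow> thesis"
    assume "h w1 \<noteq> h w2" "h w1 \<noteq> h w3" "h w2 \<noteq> h w3"
    then consider "h w1 < h w2 \<and> h w2 < h w3" | "h w1 < h w3 \<and> h w3 < h w2" | "h w2 < h w1 \<and> h w1 < h w3"
      | "h w2 < h w3 \<and> h w3 < h w1" | "h w3 < h w1 \<and> h w1 < h w2" | "h w3 < h w2 \<and> h w2 < h w1"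
      by linarith
    then show thesis by cases (use w(1) in \<open>blast intro: *\<close>)+
  qed
  then have E: "(v, x) \<in> E" "(v, c) \<in> E" "(v, y) \<in> E" by auto
  then have V: "x \<in> V" "c \<in> V" "y \<in> V" using edges by auto
  have gt: "h v < h u" if "u \<in> V" "u \<noteq> v" for u
    using v(2)[OF that(1)] h_eqD[OF that(1) v(1)] that(2) by linarith
  have vx: "h v < h x" using gt[OF V(1)] E(1) irrefl by auto
  show thesis
  proof (cases "\<exists>b d. (b, d) \<in> E \<and> h v < h b \<and> h b < h c \<and> (h d < h v \<or> h c < h d)")
    case False
    then have "enclosed v c" using uncrossed_enclosed[OF E(2)] by blast
    then show thesis using cut[OF _ v(1) V(2) _ V(3)] vx xcy V by (auto simp: between_def)
  next
    case True
    then obtain b d where bd: "(b, d) \<in> E" "h v < h b" "h b < h c" "h d < h v \<or> h c < h d" by blast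
    have bdV: "b \<in> V" "d \<in> V" using bd edges by auto
    have cd: "h c < h d" using bd v bdV by force
    have enc: "enclosed v b" "enclosed b c" using crossed_enclosed[OF E(2) bd] by auto
    \<comment> \<open>The roles of the chords are exchanged: \<open>bd\<close> is crossed by
      \<open>cv\<close> at \<open>c\<close>.\<close>
    have enc': "enclosed c d" using crossed_enclosed[OF bd(1) sym[OF E(2)]] bd cd by auto
    have "card {v, b, c, d} \<le> 4" by (simp add: card_insert_if)
    then have "\<not> V \<subseteq> {v, b, c, d}" using n card_mono[of "{v, b, c, d}" V] by auto
    then obtain z where z: "z \<in> V" "z \<notin> {v, b, c, d}" by auto
    then have "h z \<noteq> h b" "h z \<noteq> h c" "h z \<noteq> h d" "h v < h z"
      using h_eqD bdV V gt by auto
    then consider "z \<in> between v b" | "z \<in> between b c" | "z \<in> between c d" | "h d < h z"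
      using z by (fastforce simp: between_def)
    then show thesis
    proof cases
      case 1 then show thesis using cut[OF enc(1) v(1) bdV(1) _ V(2)] bd by auto
    next
      case 2 then show thesis using cut[OF enc(2) bdV(1) V(2) _ bdV(2)] cd by auto
    next
      case 3 then show thesis using cut[OF enc' V(2) bdV(2) _ v(1)] bd by auto
    next
      case 4
      \<comment> \<open>The fourth arc runs from \<open>d\<close> past the point where the circle is
        cut to \<open>v\<close>, so it is no \<open>between\<close> set. An edge from it to a vertex
        between \<open>v\<close> and \<open>d\<close> alternates with \<open>vc\<close> or with
        \<open>bd\<close>, because the ranges \<open>v\<close> to \<open>c\<close> and
        \<open>b\<close> to \<open>d\<close> overlap.\<close>
      show thesis
      proof (rule that[of v d "{z \<in> V. h d < h z}"])
        have "c \<in> V - {v, d} - {z \<in> V. h d < h z}" using bd cd V by auto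
        moreover have "{z \<in> V. h d < h z} \<subseteq> V - {v, d}" using v(2)[OF bdV(2)] by auto
        ultimately show "{z \<in> V. h d < h z} \<subset> V - {v, d}" by blast
        show "E `` {z \<in> V. h d < h z} \<subseteq> {z \<in> V. h d < h z} \<union> {v, d}"
        proof
          fix t assume "t \<in> E `` {z \<in> V. h d < h z}"
          then obtain s where st: "(s, t) \<in> E" "s \<in> {z \<in> V. h d < h z}" by auto
          then have ts: "(t, s) \<in> E" "t \<in> V" "h d < h s" using sym edges by auto
          have "h v < h c" using bd by linarith
          have "b = t \<and> d = s" if "h v < h t" "h t < h c"
            by (rule crossed_once[OF E(2) bd(1) ts(1)]) (use that bd ts cd in linarith)+
          moreover have "c = t \<and> v = s" if "h b < h t" "h t < h d"
            by (rule crossed_once[OF bd(1) sym[OF E(2)] ts(1)]) (use that bd ts cd in linarith)+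
          ultimately have "\<not> (h v < h t \<and> h t < h d)"
            using ts(3) bd(2,3) cd by force
          then have "t = v \<or> \<not> h t < h d" using gt[OF ts(2)] by auto
          then consider "t = v" | "h d < h t" | "h t = h d" by linarith
          then show "t \<in> {z \<in> V. h d < h z} \<union> {v, d}"
            by cases (use ts(2) h_eqD[OF ts(2) bdV(2)] in auto)
        qed
      next
        show "{z \<in> V. h d < h z} \<noteq> {}" using z(1) 4 by blast
      qed (fact v(1) bdV(2))+
    qed
  qed
qed

end

section \<open>Vertex cuts and end blocks\<close>

text \<open>In a symmetric graph, \<open>I\<close> is a union of some but not all components of the
  graph without \<open>S\<close>. This form is checked edge by edge, without paths.\<close>

definition separates :: "('a, 'b) pre_digraph \<Rightarrow> 'a set \<Rightarrow> bool" where
  "separates G S \<longleftrightarrow> (\<exists>I. I \<noteq> {} \<and> I \<subset> verts G - S \<and> arcs_ends G `` I \<subseteq> I \<union> S)"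

lemma arcs_ends_induce: "arcs_ends (G \<restriction> W) = arcs_ends G \<inter> W \<times> W"
  by (auto simp: arcs_ends_conv)

lemma (in wf_digraph) arcs_ends_subset: "arcs_ends G \<subseteq> verts G \<times> verts G"
  by (auto simp: arcs_ends_conv)

text \<open>The set reachable from one vertex serves as \<open>I\<close>; conversely no walk
  avoiding \<open>S\<close> leaves \<open>I\<close>. The assumption excludes the empty graph, which
  counts as not connected although nothing separates it.\<close>

lemma (in sym_digraph) not_connected_iff_separates:
  assumes "verts G - S \<noteq> {}"
  shows "\<not> Digraph_Component.connected (G \<restriction> (verts G - S)) \<longleftrightarrow> separates G S"
proof -
  let ?W = "verts G - S" and ?E = "arcs_ends G"
  have E: "(arcs_ends (G \<restriction> ?W))\<^sup>s = ?E \<inter> ?W \<times> ?W"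
    using graph_symmetric by (auto simp: symcl_def arcs_ends_induce)
  let ?R = "rtrancl_on ?W (?E \<inter> ?W \<times> ?W)"
  have conn: "Digraph_Component.connected (G \<restriction> ?W) \<longleftrightarrow> (\<forall>u\<in>?W. \<forall>v\<in>?W. (u, v) \<in> ?R)"
    using assms by (simp add: connected_conv E)
  show ?thesis
  proof
    assume "\<not> Digraph_Component.connected (G \<restriction> ?W)"
    then obtain u v where uv: "u \<in> ?W" "v \<in> ?W" "(u, v) \<notin> ?R" using conn by blast
    let ?I = "{w. (u, w) \<in> ?R}"
    have "u \<in> ?I" using uv(1) by (auto intro: rtrancl_on_refl)
    moreover have "?I \<subset> ?W"
    proof
      show "?I \<subseteq> ?W" by (auto dest: in_rtrancl_on_in_F)
      show "?I \<noteq> ?W" using uv(2,3) by blast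
    qed
    moreover have "?E `` ?I \<subseteq> ?I \<union> S"
    proof (clarify)
      fix x y assume xy: "(x, y) \<in> ?E" "(u, x) \<in> ?R" "y \<notin> S"
      then have "x \<in> ?W" "y \<in> ?W" using arcs_ends_subset by (auto dest: in_rtrancl_on_in_F)
      then show "(u, y) \<in> ?R" using xy by (auto intro: rtrancl_on_into_rtrancl_on)
    qed
    ultimately show "separates G S" unfolding separates_def by (intro exI[of _ ?I]) auto
  next
    assume "separates G S"
    then obtain I where I: "I \<noteq> {}" "I \<subset> ?W" "?E `` I \<subseteq> I \<union> S"
      unfolding separates_def by blast
    then obtain u v where uv: "u \<in> I" "v \<in> ?W" "v \<notin> I" by blast
    have "w \<in> I" if "(u, w) \<in> ?R" for w
      using that
    proof (induction rule: rtrancl_on_induct)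
      case base
      show ?case by (fact uv(1))
    next
      case (step y z)
      then show ?case using I(3) by blast
    qed
    moreover have "u \<in> ?W" using uv(1) I(2) by blast
    ultimately show "\<not> Digraph_Component.connected (G \<restriction> ?W)" using conn uv(2,3) by blast
  qed
qed

lemma (in graph) vertex_connectivity_le:
  assumes "separates G S" "S \<subseteq> verts G"
  shows "vertex_connectivity G \<le> card S"
proof -
  have "verts G - S \<noteq> {}" using assms by (auto simp: separates_def)
  then show ?thesis using assms not_connected_iff_separates
    unfolding vertex_connectivity_def by (intro Least_le) blast
qed

lemma (in graph) vertex_connectivity_le_card:
  assumes "S \<subseteq> verts G" "card (verts G - S) \<le> 1"
  shows "vertex_connectivity G \<le> card S"
  using assms unfolding vertex_connectivity_def by (intro Least_le) blast

text \<open>The first assumption handles the convention for complete graphs: leaving at most one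
  vertex takes at least \<open>card (verts G) - 1\<close> deletions.\<close>

lemma (in graph) le_vertex_connectivity:
  assumes "k < card (verts G)"
    and "\<And>S. S \<subseteq> verts G \<Longrightarrow> card S < k \<Longrightarrow> \<not> separates G S"
  shows "k \<le> vertex_connectivity G"
proof -
  let ?P = "\<lambda>k. \<exists>S \<subseteq> verts G. card S = k \<and>
     (card (verts G - S) \<le> 1 \<or> \<not> Digraph_Component.connected (G \<restriction> (verts G - S)))"
  have "?P (card (verts G))" by (intro exI[of _ "verts G"]) auto
  then have "?P (vertex_connectivity G)" unfolding vertex_connectivity_def by (rule LeastI)
  then obtain S where S: "S \<subseteq> verts G" "card S = vertex_connectivity G"
    "card (verts G - S) \<le> 1 \<or> \<not> Digraph_Component.connected (G \<restriction> (verts G - S))" by blast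
  have "card (verts G - S) = card (verts G) - card S"
    using S(1) by (meson card_Diff_subset finite_subset finite_verts)
  then show ?thesis
    using assms not_connected_iff_separates[of S] S by (cases "verts G - S = {}"; force)
qed

lemma (in graph) out_degree_eq_card: "out_degree G v = card (arcs_ends G `` {v})"
proof -
  have "arcs_ends G `` {v} = head G ` out_arcs G v" by (auto simp: arcs_ends_conv out_arcs_def)
  moreover have "inj_on (head G) (out_arcs G v)"
    by (auto simp: inj_on_def arc_to_ends_def intro: no_multi_arcs)
  ultimately show ?thesis by (simp add: out_degree_def card_image)
qed

lemma (in graph) irrefl_arcs_ends: "(x, x) \<notin> arcs_ends G"
  using no_loops by (auto simp: arcs_ends_conv)

lemma (in graph) graph_induce_subgraph:
  assumes "W \<subseteq> verts G"
  shows "graph (G \<restriction> W)"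
proof -
  interpret W: wf_digraph "G \<restriction> W" by (rule wellformed_induce_subgraph)
  show ?thesis
  proof
    show "finite (verts (G \<restriction> W))" using assms finite_subset[OF _ finite_verts] by auto
    show "symmetric (G \<restriction> W)"
      using graph_symmetric unfolding symmetric_def sym_def arcs_ends_induce by blast
  qed (auto intro: no_multi_arcs dest: no_loops)
qed

text \<open>It serves maximality of blocks: a subgraph of \<open>G\<close> properly containing an
  induced one must have a new vertex.\<close>

lemma subgraph_eq_induceI:
  assumes "subgraph H G" "subgraph (G \<restriction> verts H) H"
  shows "H = G \<restriction> verts H"
proof (rule pre_digraph.equality)
  show "arcs H = arcs (G \<restriction> verts H)"
    using assms unfolding subgraph_def wf_digraph_def by (fastforce simp: compatible_def)
qed (use assms in \<open>auto simp: subgraph_def compatible_def\<close>)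

text \<open>The block is found as \<open>C \<union> {v}\<close> for a smallest nonempty \<open>C\<close> with all edges leaving \<open>C\<close>
  ending in a single vertex \<open>v\<close>.\<close>

lemma (in graph) obtain_end_block:
  assumes "verts G \<noteq> {}" and deg: "\<And>x. x \<in> verts G \<Longrightarrow> 2 \<le> out_degree G x"
  obtains W v where "W \<subseteq> verts G" "v \<in> W" "3 \<le> card W" "block G (G \<restriction> W)"
    "arcs_ends G `` (W - {v}) \<subseteq> W"
proof -
  let ?E = "arcs_ends G"
  define pendant where "pendant C v \<longleftrightarrow> C \<noteq> {} \<and> C \<subseteq> verts G \<and> v \<in> verts G - C \<and> ?E `` C \<subseteq> insert v C" for C v
  have fin: "finite A" if "A \<subseteq> verts G" for A using that finite_subset[OF _ finite_verts] by auto
  have nbr: "2 \<le> card (?E `` {x})" if "x \<in> verts G" for x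
    using deg[OF that] by (simp add: out_degree_eq_card)
  \<comment> \<open>All vertices but one form a pendant set, nonempty because the omitted vertex has
    a neighbour.\<close>
  have "\<exists>C v. pendant C v"
  proof -
    obtain v where v: "v \<in> verts G" using assms(1) by auto
    then have "?E `` {v} \<noteq> {}" using nbr by force
    then have "verts G - {v} \<noteq> {}" using irrefl_arcs_ends arcs_ends_subset by fast
    then have "pendant (verts G - {v}) v" unfolding pendant_def using v arcs_ends_subset by auto
    then show ?thesis by blast
  qed
  then obtain Cv where "pendant (fst Cv) (snd Cv) \<and> (\<forall>Dw. pendant (fst Dw) (snd Dw) \<longrightarrow> card (fst Cv) \<le> card (fst Dw))"
    using ex_has_least_nat[of "\<lambda>p. pendant (fst p) (snd p)" _ "\<lambda>p. card (fst p)"] by (metis fst_conv snd_conv)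
  then obtain C v where Cv: "pendant C v" and least: "\<And>D w. pendant D w \<Longrightarrow> card C \<le> card D"
    by (metis fst_conv snd_conv)
  have C: "C \<noteq> {}" "C \<subseteq> verts G" "v \<in> verts G" "v \<notin> C" "?E `` C \<subseteq> insert v C"
    using Cv by (auto simp: pendant_def)
  have small: "D = C" if "D \<noteq> {}" "D \<subseteq> C" "w \<in> verts G" "w \<notin> D" "?E `` D \<subseteq> insert w D" for D w
  proof -
    have "pendant D w" using that C by (auto simp: pendant_def)
    then show ?thesis using least that(2) fin[OF C(2)] by (meson card_seteq)
  qed
  define W where "W = insert v C"
  let ?B = "G \<restriction> W"
  have WG: "W \<subseteq> verts G" using C by (auto simp: W_def)
  interpret B: graph ?B using graph_induce_subgraph[OF WG] .
  obtain x where x: "x \<in> C" using C by auto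
  \<comment> \<open>Here the degree bound 2 rules out that the end block is a bridge: both
    neighbours of \<open>x\<close> lie in \<open>W\<close>.\<close>
  have cW: "3 \<le> card W"
  proof -
    have "?E `` {x} \<subseteq> W - {x}" using x C irrefl_arcs_ends by (auto simp: W_def)
    then have "2 \<le> card (W - {x})" using nbr[of x] x C card_mono[of "W - {x}" "?E `` {x}"] fin[OF WG]
      by fastforce
    then show ?thesis using x by (simp add: W_def card_Diff_singleton_if split: if_splits)
  qed
  have "2 \<le> vertex_connectivity ?B"
  proof (rule B.le_vertex_connectivity)
    show "2 < card (verts ?B)" using cW by simp
    fix S assume S: "S \<subseteq> verts ?B" "card S < 2"
    show "\<not> separates ?B S"
    proof
      assume "separates ?B S"
      then obtain I where I: "I \<noteq> {}" "I \<subset> W - S" "arcs_ends ?B `` I \<subseteq> I \<union> S" by (auto simp: separates_def)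
      \<comment> \<open>\<open>D\<close> is the side of the cut that avoids \<open>v\<close>. Being
        inside \<open>C\<close>, it has no edges leaving \<open>W\<close>, so it is again pendant
        and \<open>small\<close> forces \<open>D = C\<close>.\<close>
      define D where "D = (if v \<in> I then W - S - I else I)"
      have cl: "y \<in> D \<union> S" if "(z, y) \<in> arcs_ends ?B" "z \<in> D" for z y
      proof -
        have "y \<in> W" "(y, z) \<in> arcs_ends ?B"
          using that B.arcs_ends_subset B.graph_symmetric by auto
        then show ?thesis using that I by (auto simp: D_def split: if_splits)
      qed
      have D: "D \<noteq> {}" "D \<subseteq> C" "D \<inter> S = {}" using I by (auto simp: D_def W_def split: if_splits)
      have DE: "?E `` D \<subseteq> D \<union> S"
      proof (clarify)
        fix z y assume zy: "(z, y) \<in> ?E" "z \<in> D" "y \<notin> S"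
        then have "z \<in> C" using D by auto
        then have "(z, y) \<in> arcs_ends ?B" using zy C by (auto simp: arcs_ends_induce W_def)
        then show "y \<in> D" using cl zy by auto
      qed
      show False
      proof (cases "S = {}")
        case True
        \<comment> \<open>Now \<open>C\<close> has no leaving edges at all, so dropping any
          \<open>x\<close> from it leaves a smaller pendant set, attached at
          \<open>x\<close>.\<close>
        have "D = C" using small[of D v] D DE C True by auto
        have "card (C - {x}) \<noteq> 0" using cW x C fin[OF C(2)] by (auto simp: W_def)
        then have "C - {x} \<noteq> {}" by force
        moreover have "?E `` (C - {x}) \<subseteq> insert x (C - {x})" using DE \<open>D = C\<close> True by auto
        ultimately have "C - {x} = C" using small[of "C - {x}" x] x C by auto
        then show False using x by auto
      next
        case False
        then have "card S = 1" using S fin[of S] WG by (auto simp: less_2_cases_iff card_eq_0_iff)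
        then obtain s where s: "S = {s}" by (auto simp: card_1_singleton_iff)
        then have "s \<notin> D" "s \<in> W" using D S by auto
        then have "D = C" using small[of D s] D DE s WG by auto
        then have "s = v" using \<open>s \<notin> D\<close> \<open>s \<in> W\<close> by (auto simp: W_def)
        \<comment> \<open>\<open>D = C\<close> fills \<open>W - {v}\<close>, so no vertex is left
          for the other side of the cut.\<close>
        then show False using I \<open>D = C\<close> C s by (auto simp: D_def W_def split: if_splits)
      qed
    qed
  qed
  then have B2: "two_connected ?B" using B.graph_axioms by (simp add: two_connected_def)
  have "max_subgraph two_connected ?B"
    unfolding max_subgraph_def
  proof (intro conjI allI impI notI)
    show "subgraph ?B G" using WG by (rule subgraph_induce_subgraphI)
    fix H assume H: "H \<noteq> ?B \<and> subgraph ?B H" "subgraph H G \<and> two_connected H"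
    interpret H: graph H using H by (simp add: two_connected_def)
    \<comment> \<open>A larger \<open>H\<close> has a vertex outside \<open>W\<close>, and then
      \<open>v\<close> separates \<open>C\<close> from it.\<close>
    have "W \<noteq> verts H" using H subgraph_eq_induceI[of H G] by metis
    then have CH: "C \<subset> verts H - {v}" "v \<in> verts H" using H C by (auto simp: W_def subgraph_def)
    moreover have "arcs_ends H `` C \<subseteq> C \<union> {v}" using arcs_ends_mono[of H G] H C by blast
    ultimately have "separates H {v}" using C unfolding separates_def by blast
    then have "vertex_connectivity H \<le> 1" using H.vertex_connectivity_le[of "{v}"] CH by simp
    then show False using H by (simp add: two_connected_def)
  qed (fact B2)
  then have "block G ?B" by (simp add: block_def)
  moreover have "?E `` (W - {v}) \<subseteq> W" using C by (auto simp: W_def)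
  moreover have "v \<in> W" by (simp add: W_def)
  ultimately show thesis using that[of W v] WG cW by blast
qed

section \<open>Layouts of pseudo-outerplanar graphs\<close>

lemma crosses_commute: "crosses pos \<gamma> e f \<longleftrightarrow> crosses pos \<gamma> f e"
  by (auto simp: crosses_def Int_commute)

lemma finite_uedges:
  assumes "finite (arcs G)"
  shows "finite (uedges G)"
proof -
  have "uedges G = (\<lambda>(u, v). {u, v}) ` arcs_ends G" by (auto simp: uedges_def)
  then show ?thesis using assms by (simp add: arcs_ends_conv)
qed

lemma uedgesI: "(u, v) \<in> arcs_ends G \<Longrightarrow> {u, v} \<in> uedges G"
  by (auto simp: uedges_def)

text \<open>The order is the boundary coordinate \<open>h\<close> of
  \<open>interlaced_paths_in_disk_meet\<close>, with \<open>p\<close> a point of the circle that is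
  no vertex. Such a point exists because the circle is infinite.\<close>

lemma exists_crossing_order:
  fixes G :: "('a, 'b) pre_digraph"
  assumes "fin_digraph G" and r: "0 < r" and dr: "drawing_in_disk G c r pos \<gamma>"
  shows "\<exists>h :: 'a \<Rightarrow> real. inj_on h (verts G) \<and>
    (\<forall>a b s t. (a, s) \<in> arcs_ends G \<longrightarrow> (b, t) \<in> arcs_ends G \<longrightarrow>
      h a < h b \<longrightarrow> h b < h s \<longrightarrow> h s < h t \<longrightarrow> crosses pos \<gamma> {a, s} {b, t})"
proof -
  interpret fin_digraph G by fact
  have inj: "inj_on pos (verts G)" and sph: "pos ` verts G \<subseteq> sphere c r"
    using dr unfolding drawing_in_disk_def by auto
  have \<gamma>: "Path_Connected.arc (\<gamma> e)" "{pathstart (\<gamma> e), pathfinish (\<gamma> e)} = pos ` e" "path_image (\<gamma> e) \<subseteq> cball c r"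
      if "e \<in> uedges G" for e
    using dr that unfolding drawing_in_disk_def by auto
  have "infinite (sphere c r)"
  proof
    assume "finite (sphere c r)"
    moreover have "Topological_Spaces.connected (sphere c r)" by (simp add: connected_sphere)
    moreover have "c + r \<in> sphere c r" "c - r \<in> sphere c r" using r by (auto simp: dist_norm)
    ultimately have "c + r = c - r" using connected_finite_iff_sing[of "sphere c r"] by fastforce
    then show False using r by (simp add: complex_eq_iff)
  qed
  then obtain q where q: "q \<in> sphere c r" "q \<notin> pos ` verts G"
    by (meson finite_imageI finite_subset finite_verts subsetI)
  define p where "p = q - c"
  define z where "z v = pos v - c" for v
  define H where "H w = Re (\<i> * (p + w) / (p - w))" for w
  have p: "norm p = r" using q by (simp add: p_def dist_norm norm_minus_commute)
  have z: "norm (z v) = r \<and> z v \<noteq> p" if "v \<in> verts G" for v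
    using sph q that by (auto simp: z_def p_def dist_norm norm_minus_commute)
  \<comment> \<open>On the circle the Moebius map is real, so its real part determines its value,
    and the map is injective.\<close>
  have H_inj: "w = w'" if "H w = H w'" "norm w = r" "norm w' = r" "w \<noteq> p" "w' \<noteq> p" for w w'
  proof -
    have Im: "Im (\<i> * (p + u) / (p - u)) = 0" if "norm u = r" for u
    proof -
      have "(Re p)\<^sup>2 + (Im p)\<^sup>2 = (Re u)\<^sup>2 + (Im u)\<^sup>2"
        using p that by (metis cmod_power2)
      then show ?thesis
        by (simp add: Im_divide power2_eq_square algebra_simps)
    qed
    have "\<i> * (p + w) / (p - w) = \<i> * (p + w') / (p - w')"
      using that Im by (intro complex_eqI) (auto simp: H_def)
    then have "(p + w) * (p - w') = (p + w') * (p - w)"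
      using that by (simp add: divide_simps)
    then have "p * w = p * w'" by (simp add: algebra_simps)
    then show "w = w'" using p r by auto
  qed
  show ?thesis
  proof (intro exI[of _ "H \<circ> z"] conjI allI impI)
    show "inj_on (H \<circ> z) (verts G)"
    proof (rule inj_onI)
      fix u v assume uv: "u \<in> verts G" "v \<in> verts G" "(H \<circ> z) u = (H \<circ> z) v"
      then have "z u = z v" using H_inj[of "z u" "z v"] z by auto
      then show "u = v" using inj uv by (auto simp: z_def dest: inj_onD)
    qed
    fix a b s t assume as: "(a, s) \<in> arcs_ends G" and bt: "(b, t) \<in> arcs_ends G"
      and lt: "(H \<circ> z) a < (H \<circ> z) b" "(H \<circ> z) b < (H \<circ> z) s" "(H \<circ> z) s < (H \<circ> z) t"
    have V: "a \<in> verts G" "s \<in> verts G" "b \<in> verts G" "t \<in> verts G"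
      using as bt arcs_ends_subset by auto
    \<comment> \<open>A drawing does not fix the direction of its curves, so one may have to be
      reversed.\<close>
    have route: "\<exists>f. path f \<and> path_image f = (\<lambda>x. x - c) ` path_image (\<gamma> {u, v}) \<and> path_image f \<subseteq> cball 0 r \<and>
        pathstart f = z u \<and> pathfinish f = z v" if "(u, v) \<in> arcs_ends G" for u v
    proof -
      have e: "{u, v} \<in> uedges G" using that by (rule uedgesI)
      define f where "f = (\<lambda>x. x - c) \<circ> \<gamma> {u, v}"
      have f: "path f" "path_image f = (\<lambda>x. x - c) ` path_image (\<gamma> {u, v})"
        unfolding f_def using arc_imp_path[OF \<gamma>(1)[OF e]]
        by (auto simp: path_image_compose intro!: path_continuous_image continuous_intros)
      have sub: "path_image f \<subseteq> cball 0 r" using \<gamma>(3)[OF e] f(2)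
        by (auto simp: dist_norm norm_minus_commute)
      have "{pathstart f, pathfinish f} = {z u, z v}"
        using \<gamma>(2)[OF e] by (auto simp: f_def z_def pathstart_compose pathfinish_compose doubleton_eq_iff)
      then consider "pathstart f = z u" "pathfinish f = z v" | "pathstart f = z v" "pathfinish f = z u"
        by (auto simp: doubleton_eq_iff)
      then show ?thesis
      proof cases
        case 1
        then show ?thesis using f sub by blast
      next
        case 2
        then show ?thesis using f sub by (intro exI[of _ "reversepath f"]) auto
      qed
    qed
    obtain f where f: "path f" "path_image f = (\<lambda>x. x - c) ` path_image (\<gamma> {a, s})" "path_image f \<subseteq> cball 0 r"
        "pathstart f = z a" "pathfinish f = z s" using route[OF as] by blast
    obtain g where g: "path g" "path_image g = (\<lambda>x. x - c) ` path_image (\<gamma> {b, t})" "path_image g \<subseteq> cball 0 r"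
        "pathstart g = z b" "pathfinish g = z t" using route[OF bt] by blast
    have "path_image f \<inter> path_image g \<noteq> {}"
      by (rule interlaced_paths_in_disk_meet[OF p r f(1,3) g(1,3)])
        (use V z lt in \<open>auto simp: f g H_def\<close>)
    then have "path_image (\<gamma> {a, s}) \<inter> path_image (\<gamma> {b, t}) \<noteq> {}" by (auto simp: f(2) g(2))
    moreover have "{a, s} \<inter> {b, t} = {}" using lt by auto
    ultimately show "crosses pos \<gamma> {a, s} {b, t}" by (auto simp: crosses_def)
  qed
qed

text \<open>Cutting the circle just before the prescribed vertex \<open>v\<close> makes it the first one.\<close>

lemma exists_circular_layout:
  fixes B :: "('a, 'b) pre_digraph"
  assumes "pseudo_outerplanar G" "block G B" "graph B" and v: "v \<in> verts B"
  shows "\<exists>h :: 'a \<Rightarrow> real. circular_layout (verts B) (arcs_ends B) h \<and> (\<forall>x \<in> verts B. h v \<le> h x)"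
proof -
  interpret graph B by fact
  obtain c r pos \<gamma> where r: "0 < r" and dr: "drawing_in_disk B c r pos \<gamma>"
    and one: "\<And>e. e \<in> uedges B \<Longrightarrow> card {f \<in> uedges B. crosses pos \<gamma> e f} \<le> 1"
    using assms(1,2) unfolding pseudo_outerplanar_def by blast
  let ?E = "arcs_ends B" and ?X = "\<lambda>a s b t. crosses pos \<gamma> {a, s} {b, t}"
  obtain h0 :: "'a \<Rightarrow> real" where inj0: "inj_on h0 (verts B)"
    and X0: "\<And>a b s t. \<lbrakk>(a, s) \<in> ?E; (b, t) \<in> ?E; h0 a < h0 b; h0 b < h0 s; h0 s < h0 t\<rbrakk> \<Longrightarrow> ?X a s b t"
    using exists_crossing_order[OF fin_digraph_axioms r dr] by blast
  \<comment> \<open>\<open>K\<close> exceeds the spread of \<open>h0\<close>, so adding it moves the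
    vertices before \<open>v\<close> behind all others: the cyclic order is rotated.\<close>
  define K where "K = Max (h0 ` verts B) - Min (h0 ` verts B) + 1"
  define h where "h x = (if h0 x < h0 v then h0 x + K else h0 x)" for x
  have K: "h0 x < h0 y + K" if "x \<in> verts B" "y \<in> verts B" for x y
  proof -
    have "h0 x \<le> Max (h0 ` verts B)" "Min (h0 ` verts B) \<le> h0 y" using that by auto
    then show ?thesis by (simp add: K_def)
  qed
  have X: "?X a s b t" if "(a, s) \<in> ?E" "(b, t) \<in> ?E" "h a < h b" "h b < h s" "h s < h t" for a b s t
  proof -
    have V: "a \<in> verts B" "s \<in> verts B" "b \<in> verts B" "t \<in> verts B"
      using that arcs_ends_subset by auto
    note E = that(1,2) graph_symmetric[OF that(1)] graph_symmetric[OF that(2)]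
    have lt: "(h0 x < h0 v \<longrightarrow> h0 y < h0 v) \<and> ((h0 x < h0 v \<longleftrightarrow> h0 y < h0 v) \<longrightarrow> h0 x < h0 y)"
      if "h x < h y" "x \<in> verts B" "y \<in> verts B" for x y
      using that K[OF that(3,2)] by (auto simp: h_def split: if_splits)
    note lts = lt[OF that(3) V(1,3)] lt[OF that(4) V(3,2)] lt[OF that(5) V(2,4)]
    \<comment> \<open>Before the rotation any of the four ends may have come first. Alternation
      survives rotation, up to exchanging the chords or their ends.\<close>
    consider "h0 a < h0 b" "h0 b < h0 s" "h0 s < h0 t" | "h0 t < h0 a" "h0 a < h0 b" "h0 b < h0 s"
      | "h0 s < h0 t" "h0 t < h0 a" "h0 a < h0 b" | "h0 b < h0 s" "h0 s < h0 t" "h0 t < h0 a"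
      using lts by (smt (verit))
    then show ?thesis
    proof cases
      case 1 then show ?thesis using X0[OF E(1,2)] by blast
    next
      case 2 then show ?thesis using X0[OF E(4,1)] by (metis crosses_commute insert_commute)
    next
      case 3 then show ?thesis using X0[OF E(3,4)] by (metis insert_commute)
    next
      case 4 then show ?thesis using X0[OF E(2,3)] by (metis crosses_commute insert_commute)
    qed
  qed
  show ?thesis
  proof (intro exI[of _ h] conjI ballI)
    show "h v \<le> h x" if "x \<in> verts B" for x
      using K[OF v that] by (auto simp: h_def)
    show "circular_layout (verts B) ?E h"
    proof
      show "inj_on h (verts B)"
      proof (rule inj_onI)
        fix x y assume xy: "x \<in> verts B" "y \<in> verts B" "h x = h y"
        then have "h0 x = h0 y" using K[OF xy(1,2)] K[OF xy(2,1)] by (auto simp: h_def split: if_splits)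
        then show "x = y" using inj0 xy by (auto dest: inj_onD)
      qed
      fix a s b t b' t' assume as: "(a, s) \<in> ?E" and bt: "(b, t) \<in> ?E" "(b', t') \<in> ?E"
        and alt: "h a < h b" "h b < h s" "h t < h a \<or> h s < h t" "h a < h b'" "h b' < h s" "h t' < h a \<or> h s < h t'"
      have X': "{b, t} \<in> {f \<in> uedges B. crosses pos \<gamma> {a, s} f}"
        if "(b, t) \<in> ?E" "h a < h b" "h b < h s" "h t < h a \<or> h s < h t" for b t
        using X[OF as that(1)] X[OF graph_symmetric[OF that(1)] as] that uedgesI[OF that(1)]
        by (auto simp: insert_commute crosses_commute)
      have "{b, t} = {b', t'}"
        using X'[OF bt(1) alt(1-3)] X'[OF bt(2) alt(4-6)] one[OF uedgesI[OF as]]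
          finite_uedges[OF finite_arcs] card_le_Suc0_iff_eq[of "{f \<in> uedges B. crosses pos \<gamma> {a, s} f}"]
        by auto
      \<comment> \<open>Only \<open>b\<close> and \<open>b'\<close> lie between \<open>a\<close> and
        \<open>s\<close>, so equal edges have equal ends in this order.\<close>
      then show "b = b' \<and> t = t'" using alt by (auto simp: doubleton_eq_iff)
    qed (use arcs_ends_subset graph_symmetric irrefl_arcs_ends in auto)
  qed
qed

text \<open>Deleting the neighbours of \<open>v\<close> either cuts \<open>v\<close> off or leaves
  only \<open>v\<close>. Both count in \<open>vertex_connectivity\<close>, which is therefore at
  most the degree.\<close>

lemma (in graph) three_connected_imp_min_degree:
  assumes "3 \<le> vertex_connectivity G" "v \<in> verts G"
  shows "3 \<le> card (arcs_ends G `` {v})"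
proof (rule ccontr)
  let ?S = "arcs_ends G `` {v}"
  assume n: "\<not> 3 \<le> card ?S"
  have S: "?S \<subseteq> verts G - {v}" using arcs_ends_subset irrefl_arcs_ends by auto
  have "\<not> card (verts G - ?S) \<le> 1"
    using vertex_connectivity_le_card[of ?S] assms n S by force
  then have "verts G - ?S \<noteq> {v}" by auto
  then have "separates G ?S" unfolding separates_def
    using S assms(2) by (intro exI[of _ "{v}"]) blast
  then show False using vertex_connectivity_le[of ?S] S assms(1) n by force
qed

section \<open>The bounds on minimum degree and connectivity\<close>

theorem theorem2p2:
  fixes G :: "('a, 'b) pre_digraph"
  assumes "graph G" and "verts G \<noteq> {}" and "pseudo_outerplanar G"
  shows "min_degree G \<le> 3 \<and>
    (\<not> complete_digraph 4 G \<longrightarrow> vertex_connectivity G \<le> 2)"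
proof
  interpret graph G by fact
  let ?E = "arcs_ends G"
  show "min_degree G \<le> 3"
  proof (rule ccontr)
    assume "\<not> min_degree G \<le> 3"
    then have deg: "4 \<le> out_degree G x" if "x \<in> verts G" for x
    proof -
      have "min_degree G \<le> out_degree G x"
        unfolding min_degree_def using that by (intro Min_le) auto
      then show ?thesis using \<open>\<not> min_degree G \<le> 3\<close> by simp
    qed
    have "2 \<le> out_degree G x" if "x \<in> verts G" for x using deg[OF that] by simp
    then obtain W v where W: "W \<subseteq> verts G" "v \<in> W" "3 \<le> card W" "block G (G \<restriction> W)"
        "?E `` (W - {v}) \<subseteq> W"
      using obtain_end_block[OF assms(2)] by blast
    have "graph (G \<restriction> W)" using W(1) by (rule graph_induce_subgraph)
    moreover have "v \<in> verts (G \<restriction> W)" using W(2) by simp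
    ultimately obtain h where h: "circular_layout (verts (G \<restriction> W)) (arcs_ends (G \<restriction> W)) h"
        "\<And>x. x \<in> verts (G \<restriction> W) \<Longrightarrow> h v \<le> h x"
      using exists_circular_layout[OF assms(3) W(4)] by blast
    have "3 \<le> card (verts (G \<restriction> W))" using W(3) by simp
    then obtain x where "x \<in> verts (G \<restriction> W)" "x \<noteq> v" "card (arcs_ends (G \<restriction> W) `` {x}) \<le> 3"
      using circular_layout.obtain_small_degree[OF h(1) \<open>v \<in> verts (G \<restriction> W)\<close> h(2)] by blast
    then have x: "x \<in> W" "x \<noteq> v" "card (arcs_ends (G \<restriction> W) `` {x}) \<le> 3" by simp_all
    \<comment> \<open>As \<open>x\<close> is not the cut vertex, its degree in the block is its
      degree in \<open>G\<close>.\<close>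
    moreover have "arcs_ends (G \<restriction> W) `` {x} = ?E `` {x}" using W(5) x by (auto simp: arcs_ends_induce)
    ultimately show False using deg[of x] W(1) by (auto simp: out_degree_eq_card)
  qed
  show "\<not> complete_digraph 4 G \<longrightarrow> vertex_connectivity G \<le> 2"
  proof (rule impI, rule ccontr)
    assume K4: "\<not> complete_digraph 4 G" and "\<not> vertex_connectivity G \<le> 2"
    then have k: "3 \<le> vertex_connectivity G" by simp
    note deg = three_connected_imp_min_degree[OF k]
    have nb: "?E `` {x} \<subseteq> verts G - {x}" for x using arcs_ends_subset irrefl_arcs_ends by auto
    obtain v where v: "v \<in> verts G" using assms(2) by auto
    have "card (verts G) \<noteq> 4"
    proof
      assume c4: "card (verts G) = 4"
      \<comment> \<open>With four vertices, degree at least 3 means adjacency to all the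
        others.\<close>
      have "?E `` {x} = verts G - {x}" if "x \<in> verts G" for x
        using nb[of x] deg[OF that] c4 that by (intro card_seteq) auto
      then have "?E = {(u, v). (u, v) \<in> verts G \<times> verts G \<and> u \<noteq> v}"
        using arcs_ends_subset irrefl_arcs_ends by blast
      then show False using K4 c4 graph_axioms by (simp add: complete_digraph_def)
    qed
    moreover have "3 \<le> card (verts G) - 1"
      using deg[OF v] card_mono[OF _ nb[of v]] v by simp
    ultimately have n: "5 \<le> card (verts G)" by linarith
    \<comment> \<open>A 3-connected \<open>G\<close> is a block of itself, so the layout is one of
      all of \<open>G\<close>.\<close>
    have "max_subgraph two_connected G"
      unfolding max_subgraph_def
    proof (intro conjI allI impI notI)
      show "two_connected G" using k graph_axioms by (simp add: two_connected_def)
      fix H assume "H \<noteq> G \<and> subgraph G H" "subgraph H G \<and> two_connected H"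
      then show False by (auto simp: subgraph_def compatible_def intro: pre_digraph.equality)
    qed (rule subgraph_refl)
    then have "block G G" by (simp add: block_def)
    then obtain h where h: "circular_layout (verts G) ?E h" "\<And>x. x \<in> verts G \<Longrightarrow> h v \<le> h x"
      using exists_circular_layout[OF assms(3) _ graph_axioms v] by blast
    obtain s t I where I: "s \<in> verts G" "t \<in> verts G" "I \<noteq> {}" "I \<subset> verts G - {s, t}" "?E `` I \<subseteq> I \<union> {s, t}"
      using circular_layout.obtain_two_cut[OF h(1) v h(2) n deg[OF v]] by blast
    then have "separates G {s, t}" unfolding separates_def by blast
    then have "vertex_connectivity G \<le> card {s, t}" using vertex_connectivity_le I(1,2) by auto
    also have "\<dots> \<le> 2" by (simp add: card_insert_if)
    finally show False using k by simp
  qed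
qed

end
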